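(* Let $n\ge 3$, $1\le t<n$, and let $c_1,c_2,\ldots,c_t\in[n]$ be distinct integers such that the sequence $(c_1,\ldots,c_t)$ avoids both patterns $123$ and $312$. If $\{c_1,\ldots,c_t\}$ is a set of consecutive integers, then $$|S_{n,(c_1,\ldots,c_t)}(123,312)|\in\bigl\{0,\ 1,\ \min\{c_1,\ldots,c_t\}\bigr\};$$ otherwise, $|S_{n,(c_1,\ldots,c_t)}(123,312)|\in\{0,1\}$.
   Context: $[n]=\{1,\ldots,n\}$ and $S_n$ is the set of permutations of $[n]$ written as sequences $(\tau(1),\ldots,\tau(n))$. A sequence of distinct integers $\tau=(\tau(1),\ldots,\tau(m))$ contains $\sigma\in S_k$ as a pattern if there are indices $1\le i_1<\cdots<i_k\le m$ such that for all $1\le a<b\le k$, $\tau(i_a)<\tau(i_b)$ if and only if $\sigma(a)<\sigma(b)$; otherwise $\tau$ avoids $\sigma$. $S_{n,(c_1,\ldots,c_t)}(\sigma_1,\ldots,\sigma_m)$ is the set of $\tau\in S_n$ with $(\tau(1),\ldots,\tau(t))=(c_1,\ldots,c_t)$ that avoid all of $\sigma_1,\ldots,\sigma_m$. A set of $t$ integers is a set of consecutive integers if it equals $\{x,x+1,\ldots,x+t-1\}$ for some $x$. *)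

theory Defs
  imports "HOL-Combinatorics.Multiset_Permutations"
begin

text \<open>
  Sequences are lists, so positions count from 0: the entry $\tau(j)$ is \<open>\<tau> ! (j - 1)\<close>,
  and $S_n$ is \<open>permutations_of_set {1..n}\<close>.
\<close>

definition contains_pattern :: "nat list \<Rightarrow> nat list \<Rightarrow> bool" where
  "contains_pattern \<tau> \<sigma> \<longleftrightarrow>
     (\<exists>i :: nat \<Rightarrow> nat.
        strict_mono_on {..<length \<sigma>} i \<and>
        (\<forall>a < length \<sigma>. i a < length \<tau>) \<and>
        (\<forall>a b. a < b \<and> b < length \<sigma> \<longrightarrow> (\<tau> ! i a < \<tau> ! i b \<longleftrightarrow> \<sigma> ! a < \<sigma> ! b)))"

abbreviation avoids :: "nat list \<Rightarrow> nat list \<Rightarrow> bool" where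
  "avoids \<tau> \<sigma> \<equiv> \<not> contains_pattern \<tau> \<sigma>"

definition avoiding_perms :: "nat \<Rightarrow> nat list \<Rightarrow> nat list set \<Rightarrow> nat list set" where
  "avoiding_perms n cs P =
     {\<tau> \<in> permutations_of_set {1..n}. take (length cs) \<tau> = cs \<and> (\<forall>\<sigma>\<in>P. avoids \<tau> \<sigma>)}"

definition consecutive_set :: "nat set \<Rightarrow> bool" where
  "consecutive_set A \<longleftrightarrow> (\<exists>x. A = {x..<x + card A})"

end

theory Submission
  imports Defs
begin

text \<open>
  Let $c$ be the first entry of an avoider. If $c = n$, then avoiding 312 forces the decreasing
  permutation. If $c < n$, then no entry between $c$ and $n$ exceeds $c$ (else 123), everything
  after $n$ decreases (else 312), and the entries below $c$ decrease (else 312). So the avoider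
  is \<open>c, c - 1, \<dots>, c - p\<close>, then \<open>n, \<dots>, c + 1\<close>, then \<open>c - p - 1, \<dots>, 1\<close> for some $p < c$, and all these
  lists are avoiders. A prefix that reaches $n$ determines $p$; a prefix that does not is a
  decreasing run \<open>c, \<dots>, c - t + 1\<close>, which allows the $c - t + 1$ values $t - 1 \le p < c$.
\<close>

section \<open>Occurrences of patterns of length three\<close>

lemma contains_pattern_3:
  "contains_pattern \<tau> [x, y, z] \<longleftrightarrow>
     (\<exists>i j k. i < j \<and> j < k \<and> k < length \<tau> \<and> (\<tau> ! i < \<tau> ! j \<longleftrightarrow> x < y) \<and>
        (\<tau> ! i < \<tau> ! k \<longleftrightarrow> x < z) \<and> (\<tau> ! j < \<tau> ! k \<longleftrightarrow> y < z))"
    (is "?L \<longleftrightarrow> ?R")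
proof
  assume ?L
  then obtain f where f: "strict_mono_on {..<3} f" "\<forall>a<3. f a < length \<tau>"
    "\<And>a b. a < b \<Longrightarrow> b < 3 \<Longrightarrow> \<tau> ! f a < \<tau> ! f b \<longleftrightarrow> [x, y, z] ! a < [x, y, z] ! b"
    unfolding contains_pattern_def by (auto simp: numeral_3_eq_3)
  have "f 0 < f 1" "f 1 < f 2"
    using f(1) by (auto intro: strict_mono_onD)
  then show ?R
    using f(2) f(3)[of 0 1] f(3)[of 0 2] f(3)[of 1 2]
    by (intro exI[of _ "f 0"] exI[of _ "f 1"] exI[of _ "f 2"]) auto
next
  assume ?R
  then obtain i j k where "i < j" "j < k" "k < length \<tau>" "\<tau> ! i < \<tau> ! j \<longleftrightarrow> x < y"
    "\<tau> ! i < \<tau> ! k \<longleftrightarrow> x < z" "\<tau> ! j < \<tau> ! k \<longleftrightarrow> y < z"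
    by blast
  then show ?L
    unfolding contains_pattern_def
    by (intro exI[of _ "(!) [i, j, k]"])
      (auto simp: less_Suc_eq nth_Cons' strict_mono_on_def)
qed

lemma contains_pattern_3_Cons:
  assumes "contains_pattern \<tau> [x, y, z]"
  shows "contains_pattern (a # \<tau>) [x, y, z]"
proof -
  from assms obtain i j k where "i < j" "j < k" "k < length \<tau>" "\<tau> ! i < \<tau> ! j \<longleftrightarrow> x < y"
    "\<tau> ! i < \<tau> ! k \<longleftrightarrow> x < z" "\<tau> ! j < \<tau> ! k \<longleftrightarrow> y < z"
    unfolding contains_pattern_3 by blast
  then show ?thesis
    unfolding contains_pattern_3
    by (intro exI[of _ "Suc i"] exI[of _ "Suc j"] exI[of _ "Suc k"]) auto
qed

lemma contains_pattern_3_append: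
  "contains_pattern \<tau> [x, y, z] \<Longrightarrow> contains_pattern (as @ \<tau>) [x, y, z]"
  by (induction as) (auto intro: contains_pattern_3_Cons)

text \<open>The head \<open>c\<close> can serve as the 1 of a 123, so entries above \<open>c\<close>
  cannot be followed by anything larger.\<close>

lemma avoids_123_sorted_wrt:
  assumes "avoids (c # xs) [1, 2, 3]"
  shows "sorted_wrt (\<lambda>a b. c < a \<longrightarrow> b \<le> a) xs"
  unfolding sorted_wrt_iff_nth_less
proof (intro allI impI, rule ccontr)
  fix i j assume *: "i < j" "j < length xs" "c < xs ! i" "\<not> xs ! j \<le> xs ! i"
  then have "contains_pattern (c # xs) [1, 2, 3]"
    unfolding contains_pattern_3
    by (intro exI[of _ 0] exI[of _ "Suc i"] exI[of _ "Suc j"]) auto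
  with assms show False by simp
qed

text \<open>Here \<open>c\<close> serves as the 3. Bounding only \<open>b\<close> by
  \<open>c\<close> suffices, since an offending \<open>a < b\<close> then lies below
  \<open>c\<close> as well.\<close>

lemma avoids_312_sorted_wrt:
  assumes "avoids (c # xs) [3, 1, 2]"
  shows "sorted_wrt (\<lambda>a b. b < c \<longrightarrow> b \<le> a) xs"
  unfolding sorted_wrt_iff_nth_less
proof (intro allI impI, rule ccontr)
  fix i j assume *: "i < j" "j < length xs" "xs ! j < c" "\<not> xs ! j \<le> xs ! i"
  then have "contains_pattern (c # xs) [3, 1, 2]"
    unfolding contains_pattern_3
    by (intro exI[of _ 0] exI[of _ "Suc i"] exI[of _ "Suc j"]) auto
  with assms show False by simp
qed

section \<open>Decreasing lists\<close>

lemma sorted_wrt_greater_unique: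
  fixes xs ys :: "'a::linorder list"
  assumes "sorted_wrt (>) xs" "sorted_wrt (>) ys" "set xs = set ys"
  shows "xs = ys"
proof -
  have "rev xs = rev ys"
    using assms by (intro strict_sorted_equal) (auto simp: sorted_wrt_rev)
  then show ?thesis by simp
qed

lemma sorted_wrt_greater_if_distinct:
  fixes xs :: "'a::linorder list"
  assumes "sorted_wrt (\<lambda>a b. b < m \<longrightarrow> b \<le> a) xs" "distinct xs" "\<forall>x\<in>set xs. x < m"
  shows "sorted_wrt (>) xs"
  using assms by (induction xs) (auto simp: order.order_iff_strict)

lemma sorted_wrt_greater_rev_upt: "sorted_wrt (>) (rev [a..<b])"
  by (simp add: sorted_wrt_rev)

section \<open>The family of avoiders with first entry \<open>c\<close>\<close>

text \<open>The last two blocks together decrease, so for \<open>c < n\<close> there are exactly two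
  decreasing runs, and \<open>p\<close> counts the entries strictly between \<open>c\<close> and
  \<open>n\<close>. For \<open>c = n\<close> the middle block is empty and every
  \<open>p < c\<close> gives the same list.\<close>

definition two_run_perm :: "nat \<Rightarrow> nat \<Rightarrow> nat \<Rightarrow> nat list" where
  "two_run_perm n c p = rev [c - p..<Suc c] @ rev [Suc c..<Suc n] @ rev [1..<c - p]"

lemma length_two_run_perm: "c \<le> n \<Longrightarrow> p < c \<Longrightarrow> length (two_run_perm n c p) = n"
  by (simp add: two_run_perm_def)

lemma nth_two_run_perm:
  assumes "c \<le> n" "p < c" "i < n"
  shows "two_run_perm n c p ! i =
    (if i \<le> p then c - i else if i \<le> p + (n - c) then Suc (n + p) - i else n - i)"
  using assms by (auto simp: two_run_perm_def nth_append rev_nth simp del: upt_Suc)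

lemma two_run_perm_in_avoiding_perms:
  assumes "c \<le> n" "p < c" "take (length cs) (two_run_perm n c p) = cs"
  shows "two_run_perm n c p \<in> avoiding_perms n cs {[1, 2, 3], [3, 1, 2]}"
proof -
  let ?w = "two_run_perm n c p"
  \<comment> \<open>A rising pair must start in the first block and end in the middle one. A 123
    would need its middle position in both blocks; in a 312 the first position would also lie in the
    first block, where entries are at most \<open>c\<close>, below the last entry of the
    pattern.\<close>
  have ascent: "i \<le> p \<and> p < j \<and> c < ?w ! j" if "i < j" "j < n" "?w ! i < ?w ! j" for i j
    using assms(1,2) that by (auto simp: nth_two_run_perm split: if_splits)
  have "avoids ?w [1, 2, 3]"
  proof
    assume "contains_pattern ?w [1, 2, 3]"
    then obtain i j k where "i < j" "j < k" "k < n" "?w ! i < ?w ! j" "?w ! j < ?w ! k"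
      using assms(1,2) by (auto simp: contains_pattern_3 length_two_run_perm)
    then show False using ascent[of i j] ascent[of j k] by auto
  qed
  moreover have "avoids ?w [3, 1, 2]"
  proof
    assume "contains_pattern ?w [3, 1, 2]"
    then obtain i j k where *: "i < j" "j < k" "k < n" "\<not> ?w ! i < ?w ! k" "?w ! j < ?w ! k"
      using assms(1,2) by (auto simp: contains_pattern_3 length_two_run_perm)
    then have "j \<le> p" "c < ?w ! k" using ascent[of j k] by auto
    moreover have "?w ! i \<le> c"
      using assms(1,2) * \<open>j \<le> p\<close> by (simp add: nth_two_run_perm)
    ultimately show False using * by simp
  qed
  moreover have "?w \<in> permutations_of_set {1..n}"
    using assms(1,2) by (auto simp: two_run_perm_def permutations_of_set_def)
  ultimately show ?thesis
    using assms(3) by (simp add: avoiding_perms_def)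
qed

section \<open>Classification of the avoiders\<close>

lemma avoiding_perm_eq_two_run_perm:
  assumes perm: "set (c # xs) = {1..n}" "distinct (c # xs)"
    and av123: "avoids (c # xs) [1, 2, 3]" and av312: "avoids (c # xs) [3, 1, 2]"
  shows "\<exists>p<c. c # xs = two_run_perm n c p"
proof (cases "c = n")
  case True
  have "\<forall>x\<in>set xs. x < n"
  proof
    fix x assume "x \<in> set xs"
    then have "x \<in> {1..n}" "x \<noteq> n" using perm True by auto
    then show "x < n" by simp
  qed
  then have "sorted_wrt (>) (c # xs)"
    using avoids_312_sorted_wrt[OF av312] perm True
    by (auto intro!: sorted_wrt_greater_if_distinct[of n])
  moreover have "set (c # xs) = set (rev [1..<Suc n])"
    unfolding perm(1) by (auto simp del: upt_Suc)
  ultimately have "c # xs = rev [1..<Suc n]"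
    by (intro sorted_wrt_greater_unique sorted_wrt_greater_rev_upt) auto
  moreover have "c \<in> {1..n}" using perm(1) by (metis list.set_intros(1))
  ultimately show ?thesis
    using True by (intro exI[of _ 0]) (auto simp: two_run_perm_def)
next
  case False
  have "c \<in> {1..n}" using perm(1) by (metis list.set_intros(1))
  then have c: "1 \<le> c" "c < n" using False by auto
  have "n \<in> set (c # xs)" unfolding perm(1) using c by simp
  then have "n \<in> set xs" using False by simp
  then obtain us vs where xs: "xs = us @ n # vs" by (auto simp: in_set_conv_decomp)
  have us_less: "u < c" if "u \<in> set us" for u
  proof -
    \<comment> \<open>\<open>n\<close> comes after \<open>u\<close>, so \<open>u\<close> above
      \<open>c\<close> would have to be at least \<open>n\<close>.\<close>
    have "c < u \<longrightarrow> n \<le> u"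
      using avoids_123_sorted_wrt[OF av123] that by (auto simp: xs sorted_wrt_append)
    moreover have "u \<noteq> c" "u \<noteq> n" "u \<le> n" using perm that by (auto simp: xs)
    ultimately show ?thesis by auto
  qed
  have vs_less: "\<forall>v\<in>set vs. v < n"
  proof
    fix v assume "v \<in> set vs"
    then have "v \<in> {1..n}" "v \<noteq> n" using perm by (auto simp: xs)
    then show "v < n" by simp
  qed
  \<comment> \<open>Dropping the entries before \<open>n\<close> makes \<open>n\<close> the head, so
    it can act as the 3 and force \<open>vs\<close> to decrease.\<close>
  have "avoids (n # vs) [3, 1, 2]"
    using contains_pattern_3_append[of "n # vs" _ _ _ "c # us"] av312 by (auto simp: xs)
  then have vs_desc: "sorted_wrt (>) (n # vs)"
    using avoids_312_sorted_wrt vs_less perm(2)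
    by (auto simp: xs intro!: sorted_wrt_greater_if_distinct[of n])

  \<comment> \<open>The values below \<open>c\<close> are split by \<open>n\<close> into
    \<open>us\<close> and \<open>?ws\<close>. Joined, they list \<open>1, ..., c - 1\<close> in
    decreasing order, so the length of \<open>us\<close> determines both parts.\<close>
  let ?ws = "filter (\<lambda>v. v < c) vs"
  have low: "us @ ?ws = filter (\<lambda>v. v < c) xs"
    using us_less c by (auto simp: xs)
  have "sorted_wrt (>) (us @ ?ws)"
    unfolding low
    using avoids_312_sorted_wrt[OF av312] perm(2)
    by (intro sorted_wrt_greater_if_distinct[of c] sorted_wrt_filter) auto
  moreover have "set (us @ ?ws) = set (rev [1..<c])"
  proof -
    have "set xs = set (c # xs) - {c}" using perm(2) by auto
    also have "\<dots> = {1..n} - {c}" unfolding perm(1) ..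
    finally have set_xs: "set xs = {1..n} - {c}" .
    have "set (us @ ?ws) = {v \<in> {1..n} - {c}. v < c}"
      unfolding low set_filter set_xs ..
    also have "\<dots> = {1..<c}" using c(2) by fastforce
    finally show ?thesis by simp
  qed
  ultimately have us_ws: "us @ ?ws = rev [1..<c]"
    by (intro sorted_wrt_greater_unique sorted_wrt_greater_rev_upt)
  define p where "p = length us"
  have "p \<le> length (us @ ?ws)" by (simp add: p_def)
  then have p: "p < c" using c unfolding us_ws by simp
  have "us = take p (us @ ?ws)" by (simp add: p_def)
  also have "\<dots> = rev [c - p..<c]"
    unfolding us_ws take_rev using p c by (simp add: drop_upt Suc_diff_Suc)
  finally have us: "us = rev [c - p..<c]" .

  \<comment> \<open>Both sides decrease, so comparing their sets is enough; the set on the left is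
    what \<open>c # us\<close> leaves over.\<close>
  have "n # vs = rev [Suc c..<Suc n] @ rev [1..<c - p]"
  proof (rule sorted_wrt_greater_unique[OF vs_desc])
    show "sorted_wrt (>) (rev [Suc c..<Suc n] @ rev [1..<c - p])"
      by (auto simp: sorted_wrt_append sorted_wrt_greater_rev_upt simp del: upt_Suc)
    have "set (n # vs) = set (c # xs) - set (c # us)"
      using perm(2) by (auto simp: xs)
    also have "\<dots> = {1..n} - set (c # us)"
      unfolding perm(1) ..
    also have "\<dots> = set (rev [Suc c..<Suc n] @ rev [1..<c - p])"
      using c p by (auto simp: us)
    finally show "set (n # vs) = set (rev [Suc c..<Suc n] @ rev [1..<c - p])" .
  qed
  then show ?thesis
    using p by (intro exI[of _ p]) (simp add: xs us two_run_perm_def)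
qed

lemma avoiding_perms_eq_two_run_perms:
  assumes "cs \<noteq> []" "hd cs \<le> n"
  shows "avoiding_perms n cs {[1, 2, 3], [3, 1, 2]} =
    two_run_perm n (hd cs) ` {p. p < hd cs \<and> take (length cs) (two_run_perm n (hd cs) p) = cs}"
    (is "?A = ?B")
proof
  show "?B \<subseteq> ?A"
    using two_run_perm_in_avoiding_perms assms(2) by blast
  show "?A \<subseteq> ?B"
  proof
    fix \<tau> assume \<tau>: "\<tau> \<in> ?A"
    then have "take (length cs) \<tau> = cs" by (simp add: avoiding_perms_def)
    with assms(1) obtain xs where xs: "\<tau> = hd cs # xs"
      by (cases \<tau>; cases cs) auto
    have "\<exists>p<hd cs. hd cs # xs = two_run_perm n (hd cs) p"
      using \<tau> unfolding xs
      by (intro avoiding_perm_eq_two_run_perm)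
        (simp_all add: avoiding_perms_def permutations_of_set_def)
    then show "\<tau> \<in> ?B"
      using \<tau> unfolding xs by (auto simp: avoiding_perms_def)
  qed
qed

section \<open>Counting the parameters compatible with a prefix\<close>

theorem theorem5p8:
  fixes n t :: nat and cs :: "nat list"
  assumes "n \<ge> 3" and "1 \<le> t" and "t < n"
    and "length cs = t" and "set cs \<subseteq> {1..n}" and "distinct cs"
    and "avoids cs [1, 2, 3]" and "avoids cs [3, 1, 2]"
  shows "(consecutive_set (set cs) \<longrightarrow>
            card (avoiding_perms n cs {[1, 2, 3], [3, 1, 2]}) \<in> {0, 1, Min (set cs)}) \<and>
         (\<not> consecutive_set (set cs) \<longrightarrow>
            card (avoiding_perms n cs {[1, 2, 3], [3, 1, 2]}) \<in> {0, 1})"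
proof -
  define c where "c = hd cs"
  define P where "P = {p. p < c \<and> take t (two_run_perm n c p) = cs}"
  let ?A = "avoiding_perms n cs {[1, 2, 3], [3, 1, 2]}"
  have "cs \<noteq> []" using assms(2,4) by auto
  then have "c \<in> set cs" by (simp add: c_def)
  then have c: "1 \<le> c" "c \<le> n" using assms(5) by auto
  have A: "?A = two_run_perm n c ` P"
    using avoiding_perms_eq_two_run_perms[OF \<open>cs \<noteq> []\<close>] c(2) assms(4)
    by (simp add: c_def P_def)
  have small: "card ?A \<in> {0, 1}" if "\<exists>w. ?A \<subseteq> {w}"
  proof -
    from that obtain w where "?A \<subseteq> {w}" by blast
    then have "card ?A \<le> card {w}" by (intro card_mono) simp_all
    then show ?thesis by (simp add: le_Suc_eq)
  qed
  \<comment> \<open>The first block has \<open>p + 1\<close> entries, so \<open>n\<close>, which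
    opens the nonempty middle block, has 0-based position \<open>Suc p\<close>.\<close>
  have max_at: "w ! Suc p = n" if "c < n" "p < c" "w = two_run_perm n c p" for p w
    using that by (simp add: nth_two_run_perm)
  \<comment> \<open>For \<open>c < n\<close>: either some compatible first block covers the whole
    prefix, or every compatible \<open>p\<close> puts \<open>n\<close> inside the prefix. The latter
    includes the case of empty \<open>P\<close>.\<close>
  consider "c = n" | "c < n" "\<exists>p\<in>P. t \<le> Suc p" | "c < n" "\<forall>p\<in>P. Suc p < t"
    using c(2) by force
  then show ?thesis
  proof cases
    case 1
    have "two_run_perm n n p = rev [1..<Suc n]" if "p < n" for p
      using that by (intro nth_equalityI)
        (auto simp: length_two_run_perm nth_two_run_perm rev_nth simp del: upt_Suc)
    then have "?A \<subseteq> {rev [1..<Suc n]}"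
      unfolding A P_def 1 by auto
    then show ?thesis using small by blast
  next
    case 2
    then obtain q where q: "q < c" "t \<le> Suc q" "take t (two_run_perm n c q) = cs"
      by (auto simp: P_def)
    \<comment> \<open>The subtraction \<open>Suc c - t\<close> is not truncated, as
      \<open>t \<le> Suc p \<le> c\<close>.\<close>
    have run: "take t (two_run_perm n c p) = rev [Suc c - t..<Suc c]" if "p < c" "t \<le> Suc p" for p
    proof (rule nth_equalityI)
      show "length (take t (two_run_perm n c p)) = length (rev [Suc c - t..<Suc c])"
        using that assms(3) c by (simp add: length_two_run_perm del: upt_Suc)
      fix i assume "i < length (take t (two_run_perm n c p))"
      then show "take t (two_run_perm n c p) ! i = rev [Suc c - t..<Suc c] ! i"
        using that assms(3) c
        by (auto simp: length_two_run_perm nth_two_run_perm rev_nth simp del: upt_Suc)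
    qed
    have cs: "cs = rev [Suc c - t..<Suc c]" using run[of q] q by simp
    then have set_cs: "set cs = {Suc c - t..<Suc c}" by (simp del: upt_Suc)
    \<comment> \<open>A smaller \<open>p\<close> would place \<open>n\<close> within
      \<open>cs\<close>, whose entries are all at most \<open>c < n\<close>.\<close>
    have P_ge: "t - 1 \<le> p" if "p \<in> P" for p
    proof (rule ccontr)
      assume "\<not> t - 1 \<le> p"
      then have "\<not> t \<le> Suc p" by simp
      then have "cs ! Suc p = n"
        using max_at[OF 2(1), of p] that by (auto simp: P_def)
      then have "n \<in> set cs"
        using \<open>\<not> t \<le> Suc p\<close> assms(4) by (metis nth_mem not_le)
      then show False using set_cs 2(1) by auto
    qed
    have P: "P = {t - 1..<c}"
    proof (intro equalityI subsetI)
      fix p assume "p \<in> {t - 1..<c}"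
      then have "p < c" "t \<le> Suc p" by auto
      then show "p \<in> P" unfolding P_def using run[of p] cs by simp
    next
      fix p assume "p \<in> P"
      then show "p \<in> {t - 1..<c}" using P_ge by (simp add: P_def)
    qed
    \<comment> \<open>The position of \<open>n\<close> recovers the parameter.\<close>
    have "inj_on (two_run_perm n c) P"
    proof (rule inj_onI)
      fix p r assume "p \<in> P" "r \<in> P" and eq: "two_run_perm n c p = two_run_perm n c r"
      then have pr: "p < c" "r < c" by (auto simp: P_def)
      have "two_run_perm n c p ! Suc p = two_run_perm n c p ! Suc r"
        using max_at[OF 2(1) pr(1) refl] max_at[OF 2(1) pr(2) eq] by simp
      moreover have "distinct (two_run_perm n c p)"
        by (auto simp: two_run_perm_def)
      ultimately show "p = r"
        using nth_eq_iff_index_eq[of "two_run_perm n c p" "Suc p" "Suc r"] pr 2(1)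
        by (simp add: length_two_run_perm)
    qed
    \<comment> \<open>The least entry of the decreasing run \<open>cs\<close> is
      \<open>c - (t - 1)\<close>, which is also the number of parameters in
      \<open>P\<close>.\<close>
    then have "card ?A = c - (t - 1)" unfolding A by (simp add: card_image P)
    moreover have "Min (set cs) = c - (t - 1)"
      unfolding set_cs using assms(2) q by (intro Min_eqI) auto
    moreover have "consecutive_set (set cs)"
      unfolding consecutive_set_def set_cs using q by (intro exI[of _ "Suc c - t"]) auto
    ultimately show ?thesis by auto
  next
    case 3
    \<comment> \<open>Each compatible parameter puts \<open>n\<close> at position
      \<open>Suc p\<close> of the distinct list \<open>cs\<close>, so there is at most one.\<close>
    have "p = r" if "p \<in> P" "r \<in> P" for p r
    proof -
      have "cs ! Suc x = n" "Suc x < length cs" if "x \<in> P" for x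
      proof -
        have x: "x < c" "take t (two_run_perm n c x) = cs" "Suc x < t"
          using that 3(2) by (auto simp: P_def)
        then have "cs ! Suc x = two_run_perm n c x ! Suc x"
          using nth_take by metis
        then show "cs ! Suc x = n" "Suc x < length cs"
          using max_at[OF 3(1)] x assms(4) by simp_all
      qed
      then show ?thesis
        using that assms(6) by (metis nth_eq_iff_index_eq nat.inject)
    qed
    then have "\<exists>w. ?A \<subseteq> {w}" unfolding A by blast
    then show ?thesis using small by blast
  qed
qed

end
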